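(* For every $C,k,\Delta>0$, there exists $C'=C'(C,k,\Delta)>0$ such that the following holds for all sufficiently large $n$. Let $H$ and $G$ be $n$-vertex $k$-uniform hypergraphs. If there is a $(C/n)$-vertex-spread distribution on embeddings $G\hookrightarrow H$ and $\Delta(G)\le\Delta$, then there is a $\left(C'/n^{1/m_1(G)}\right)$-spread distribution on subgraphs of $H$ which are isomorphic to $G$.
   Context: $\Delta(G)$ is the maximum, over vertices of $G$, of the number of edges of $G$ containing the vertex. An embedding $\varphi:G\hookrightarrow H$ of hypergraphs is an injective map $\varphi:V(G)\to V(H)$ mapping every edge of $G$ to an edge of $H$. Vertex-spread. Let $X,Y$ be finite sets and $\mu$ a probability distribution over injections $\varphi:X\to Y$. For $q\in[0,1]$, $\mu$ is $q$-vertex-spread if for every two sequences of distinct elements $x_1,\dots,x_s\in X$ and $y_1,\dots,y_s\in Y$, $\mu(\{\varphi:\varphi(x_i)=y_i\text{ for all }i\in[s]\})\le q^s$. For distributions on embeddings $G\hookrightarrow H$, take $X=V(G)$, $Y=V(H)$. Spread. For a finite hypergraph $(V,\mathcal H)$ and a probability distribution $\mu$ on $\mathcal H$, $\mu$ is $q$-spread (for $q\in[0,1]$) if $\mu(\{A\in\mathcal H:A\supseteq S\})\le q^{|S|}$ for all $S\subseteq V$. A $q$-spread distribution on subgraphs of $H$ isomorphic to $G$ means the case where $V=E(H)$ and $\mathcal H$ is the set of edge sets of subgraphs of $H$ isomorphic to $G$. Density. For a hypergraph $G$ with at least two vertices, $d_1(G):=|E(G)|/(|V(G)|-1)$, and $m_1(G):=\max_{G'\subseteq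 G:\,|V(G')|>1}d_1(G')$.
   Formalization: The uniformity k is taken to be at least 2, since for k = 1 the claim fails: let G = H be n vertices with all n singletons as edges, so m_1(G) = 2 and H is the only copy of G. *)

theory Defs
  imports "HOL-Probability.Probability"
begin

record 'a hypergraph =
  verts :: "'a set"
  edges :: "'a set set"

definition hypergraph :: "'a hypergraph \<Rightarrow> bool" where
  "hypergraph G \<longleftrightarrow> finite (verts G) \<and> edges G \<subseteq> Pow (verts G)"

definition uniform_hypergraph :: "nat \<Rightarrow> 'a hypergraph \<Rightarrow> bool" where
  "uniform_hypergraph k G \<longleftrightarrow> hypergraph G \<and> (\<forall>e\<in>edges G. card e = k)"

definition subhypergraph :: "'a hypergraph \<Rightarrow> 'a hypergraph \<Rightarrow> bool" where
  "subhypergraph G' G \<longleftrightarrow>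
     hypergraph G' \<and> verts G' \<subseteq> verts G \<and> edges G' \<subseteq> edges G"

definition hypergraph_iso :: "'a hypergraph \<Rightarrow> 'b hypergraph \<Rightarrow> bool" where
  "hypergraph_iso G H \<longleftrightarrow>
     (\<exists>f. bij_betw f (verts G) (verts H) \<and> edges H = (\<lambda>e. f ` e) ` edges G)"

text \<open>The maximum is meaningful for finite hypergraphs with at least one vertex.\<close>

definition max_degree :: "'a hypergraph \<Rightarrow> nat" where
  "max_degree G = Max ((\<lambda>v. card {e \<in> edges G. v \<in> e}) ` verts G)"

definition d1 :: "'a hypergraph \<Rightarrow> real" where
  "d1 G = real (card (edges G)) / (real (card (verts G)) - 1)"

text \<open>The maximum is meaningful for finite hypergraphs with at least two vertices.\<close>

definition m1 :: "'a hypergraph \<Rightarrow> real" where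
  "m1 G = Max {d1 G' | G'. subhypergraph G' G \<and> card (verts G') > 1}"

text \<open>Maps \<open>X \<rightarrow> Y\<close> between finite sets are extensional functions (\<open>undefined\<close> outside \<open>X\<close>),
  so there are finitely many of them and their probability distributions are exactly the
  probability mass functions supported on them.\<close>

definition injections :: "'a set \<Rightarrow> 'b set \<Rightarrow> ('a \<Rightarrow> 'b) set" where
  "injections X Y = {\<phi> \<in> X \<rightarrow>\<^sub>E Y. inj_on \<phi> X}"

definition embeddings :: "'a hypergraph \<Rightarrow> 'b hypergraph \<Rightarrow> ('a \<Rightarrow> 'b) set" where
  "embeddings G H =
     {\<phi> \<in> injections (verts G) (verts H). \<forall>e\<in>edges G. \<phi> ` e \<in> edges H}"

definition vertex_spread ::
    "real \<Rightarrow> 'a set \<Rightarrow> 'b set \<Rightarrow> ('a \<Rightarrow> 'b) pmf \<Rightarrow> bool" where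
  "vertex_spread q X Y \<mu> \<longleftrightarrow>
     finite X \<and> finite Y \<and> q \<in> {0..1} \<and> set_pmf \<mu> \<subseteq> injections X Y \<and>
     (\<forall>xs ys. distinct xs \<longrightarrow> distinct ys \<longrightarrow> set xs \<subseteq> X \<longrightarrow> set ys \<subseteq> Y \<longrightarrow>
        length xs = length ys \<longrightarrow>
        measure_pmf.prob \<mu> {\<phi>. \<forall>i<length xs. \<phi> (xs ! i) = ys ! i} \<le> q ^ length xs)"

definition spread ::
    "real \<Rightarrow> 'a set \<Rightarrow> 'a set set \<Rightarrow> 'a set pmf \<Rightarrow> bool" where
  "spread q V \<H> \<mu> \<longleftrightarrow>
     finite V \<and> \<H> \<subseteq> Pow V \<and> q \<in> {0..1} \<and> set_pmf \<mu> \<subseteq> \<H> \<and>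
     (\<forall>S\<subseteq>V. measure_pmf.prob \<mu> {A \<in> \<H>. S \<subseteq> A} \<le> q ^ card S)"

definition copies :: "'a hypergraph \<Rightarrow> 'b hypergraph \<Rightarrow> 'b set set set" where
  "copies G H = {edges G' | G'. subhypergraph G' H \<and> hypergraph_iso G' G}"

text \<open>The quantity \<open>C / n\<^bsup>1/m\<^esup>\<close> for \<open>n \<ge> 2\<close> and \<open>m \<ge> 0\<close>, with \<open>1/0 = \<infinity>\<close> and \<open>C/n\<^bsup>\<infinity>\<^esup> = 0\<close>
  (in HOL, \<open>1 / 0 = 0\<close> would give \<open>C\<close> instead). The case \<open>m = 0\<close> arises for hypergraphs
  without edges.\<close>

definition spread_rate :: "real \<Rightarrow> nat \<Rightarrow> real \<Rightarrow> real" where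
  "spread_rate C n m = (if m = 0 then 0 else C / real n powr (1 / m))"

end

theory Submission imports Defs begin

text \<open>
  The distribution \<open>\<nu>\<close> is the law of the random copy \<open>\<phi>(G)\<close> of \<open>G\<close>, where \<open>\<phi>\<close> is drawn from the
  vertex-spread distribution.  Fix a set \<open>S\<close> of \<open>s\<close> edges of \<open>H\<close> spanning \<open>v\<close> vertices.  If
  \<open>S \<subseteq> \<phi>(G)\<close>, then \<open>\<phi>\<^sup>-\<^sup>1\<close> restricts to a map \<open>\<psi>\<close> from those \<open>v\<close> vertices to the vertices of \<open>G\<close> that
  sends edges in \<open>S\<close> to edges of \<open>G\<close>.  For a given \<open>\<psi>\<close> this happens with probability at most
  \<open>(C/n)\<^sup>v\<close>, so everything depends on the number of candidates \<open>\<psi>\<close>.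

  If \<open>S\<close> has \<open>c\<close> connected components, there are at most \<open>n\<^sup>c D\<^sup>s\<close> candidates with
  \<open>D = \<Delta> k\<^sup>k\<close>: in each component the image of one vertex is arbitrary, and after that each further
  edge meets the part already placed, so its image is one of at most \<open>\<Delta>\<close> edges of \<open>G\<close>, met in at
  most \<open>k\<^sup>k\<close> ways.  On the other hand every component with \<open>s'\<close> edges and \<open>v'\<close> vertices is a copy of
  a subhypergraph of \<open>G\<close>, whence \<open>s' \<le> m\<^sub>1(G) (v' - 1)\<close>; summing over components gives
  \<open>c \<le> v - s/m\<^sub>1(G)\<close>.  Multiplying, the probability is at most
  \<open>D\<^sup>s n\<^bsup>v - s/m\<^esup> (C/n)\<^sup>v\<close>, in which the powers \<open>n\<^sup>v\<close> cancel and \<open>v \<le> k s\<close> absorbs \<open>C\<^sup>v\<close> into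
  a constant to the power \<open>s\<close>.  The count is \<open>card_edge_maps_le\<close>, and the density inequality is
  \<open>card_le_m1_of_copy\<close>.
\<close>

section \<open>Counting edge-preserving maps\<close>

definition edge_maps :: "'b set set \<Rightarrow> 'a hypergraph \<Rightarrow> ('b \<Rightarrow> 'a) set" where
  "edge_maps S G = {\<psi> \<in> \<Union>S \<rightarrow>\<^sub>E verts G. \<forall>e\<in>S. \<psi> ` e \<in> edges G}"

lemma finite_edge_maps:
  assumes "finite (\<Union>S)" "finite (verts G)"
  shows "finite (edge_maps S G)"
proof -
  have "finite (\<Union>S \<rightarrow>\<^sub>E verts G)" using assms by (intro finite_PiE) auto
  then show ?thesis unfolding edge_maps_def by simp
qed

lemma finite_edges: "hypergraph G \<Longrightarrow> finite (edges G)"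
  unfolding hypergraph_def by (meson finite_Pow_iff finite_subset)

lemma degree_le_max_degree:
  assumes "hypergraph G"
  shows "card {e \<in> edges G. v \<in> e} \<le> max_degree G"
proof (cases "v \<in> verts G")
  case True
  then show ?thesis using assms unfolding max_degree_def hypergraph_def
    by (intro Max_ge) auto
next
  case False
  then have "{e \<in> edges G. v \<in> e} = {}" using assms unfolding hypergraph_def by auto
  then show ?thesis by (metis card.empty le0)
qed

lemma restrict_edge_maps:
  assumes g: "g \<in> edge_maps S G" and T: "T \<subseteq> S"
  shows "restrict g (\<Union>T) \<in> edge_maps T G"
proof -
  have "restrict g (\<Union>T) ` e = g ` e" if "e \<in> T" for e
    using that by (intro image_cong) auto
  moreover have "restrict g (\<Union>T) \<in> \<Union>T \<rightarrow>\<^sub>E verts G"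
    unfolding restrict_PiE_iff using g T by (auto simp: edge_maps_def PiE_iff)
  ultimately show ?thesis using g T unfolding edge_maps_def by auto
qed

text \<open>A map that is already fixed at the vertex \<open>x\<close> of \<open>e\<close> must send \<open>e\<close> to one of the at most
  \<open>max_degree G\<close> edges through the image of \<open>x\<close>, and there are \<open>k ^ k\<close> functions between two
  \<open>k\<close>-sets.\<close>

lemma card_extensions_le:
  fixes G :: "'a hypergraph" and F :: "('b \<Rightarrow> 'a) set"
  assumes G: "uniform_hypergraph k G" and F: "finite F"
    and x: "x \<in> X" "x \<in> e" and e: "finite e" "card e = k"
  defines "F' \<equiv> {g \<in> extensional (X \<union> e). restrict g X \<in> F \<and> g ` e \<in> edges G}"
  shows "finite F'" "card F' \<le> card F * (max_degree G * k ^ k)"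
proof -
  have hG: "hypergraph G" and kG: "\<And>E. E \<in> edges G \<Longrightarrow> card E = k"
    using G unfolding uniform_hypergraph_def by auto
  have finE: "finite E" if "E \<in> edges G" for E
    using hG that unfolding hypergraph_def by (meson Pow_iff finite_subset subsetD)
  define B where "B f = (\<Union>E\<in>{E \<in> edges G. f x \<in> E}. e \<rightarrow>\<^sub>E E)" for f :: "'b \<Rightarrow> 'a"
  have finB: "finite (B f)" for f
    unfolding B_def using finite_edges[OF hG] finE e by (auto intro!: finite_PiE)
  have cardB: "card (B f) \<le> max_degree G * k ^ k" for f
  proof -
    have "card (B f) \<le> (\<Sum>E\<in>{E \<in> edges G. f x \<in> E}. card (e \<rightarrow>\<^sub>E E))"
      unfolding B_def using finite_edges[OF hG] by (intro card_UN_le) auto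
    also have "\<dots> = (\<Sum>E\<in>{E \<in> edges G. f x \<in> E}. k ^ k)"
      using e kG by (intro sum.cong) (auto simp: card_PiE)
    also have "\<dots> = card {E \<in> edges G. f x \<in> E} * k ^ k" by simp
    also have "\<dots> \<le> max_degree G * k ^ k"
      using degree_le_max_degree[OF hG] by (intro mult_right_mono) auto
    finally show ?thesis .
  qed
  let ?r = "\<lambda>g. (restrict g X, restrict g e)"
  have inj: "inj_on ?r F'"
  proof (rule inj_onI)
    fix g h assume gh: "g \<in> F'" "h \<in> F'" and eq: "?r g = ?r h"
    have "restrict g X y = restrict h X y" "restrict g e y = restrict h e y" for y
      using eq by auto
    then have "g y = h y" if "y \<in> X \<union> e" for y
      using that by (metis UnE restrict_apply')
    then show "g = h" using gh unfolding F'_def by (auto intro: extensionalityI)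
  qed
  have sub: "?r ` F' \<subseteq> Sigma F B"
    using x unfolding F'_def B_def by auto
  have fin: "finite (Sigma F B)" using F finB by auto
  show "finite F'" using inj sub fin by (meson finite_imageD finite_subset)
  have "card F' \<le> card (Sigma F B)" using card_inj_on_le[OF inj sub fin] .
  also have "\<dots> = (\<Sum>f\<in>F. card (B f))" using F finB by (simp add: card_SigmaI)
  also have "\<dots> \<le> (\<Sum>f\<in>F. max_degree G * k ^ k)" using cardB by (intro sum_mono) auto
  finally show "card F' \<le> card F * (max_degree G * k ^ k)" by simp
qed

lemma card_edge_maps_insert_le:
  fixes G :: "'a hypergraph" and T :: "'b set set"
  assumes G: "uniform_hypergraph k G" and T: "finite (\<Union>T)"
    and x: "x \<in> \<Union>T" "x \<in> e" and e: "finite e" "card e = k"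
  shows "card (edge_maps (insert e T) G) \<le> card (edge_maps T G) * (max_degree G * k ^ k)"
proof -
  have hG: "finite (verts G)"
    using G unfolding uniform_hypergraph_def hypergraph_def by auto
  let ?F = "{g \<in> extensional (\<Union>T \<union> e). restrict g (\<Union>T) \<in> edge_maps T G \<and> g ` e \<in> edges G}"
  note ext = card_extensions_le[OF G finite_edge_maps[OF T hG] x e]
  have "edge_maps (insert e T) G \<subseteq> ?F"
  proof
    fix g assume g: "g \<in> edge_maps (insert e T) G"
    have "restrict g (\<Union>T) \<in> edge_maps T G" by (rule restrict_edge_maps[OF g]) auto
    with g show "g \<in> ?F" by (auto simp: edge_maps_def PiE_iff Un_commute)
  qed
  then have "card (edge_maps (insert e T) G) \<le> card ?F" using ext(1) by (rule card_mono[rotated])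
  also note ext(2)
  finally show ?thesis .
qed

text \<open>The first edge of a component costs a factor \<open>card (verts G)\<close>, for the image of one of its
  vertices.\<close>

lemma card_edge_maps_singleton_le:
  fixes G :: "'a hypergraph" and e :: "'b set"
  assumes G: "uniform_hypergraph k G" and e: "finite e" "card e = k" and k: "k > 0"
  shows "card (edge_maps {e} G) \<le> card (verts G) * (max_degree G * k ^ k)"
proof -
  have hG: "finite (verts G)"
    using G unfolding uniform_hypergraph_def hypergraph_def by auto
  obtain x where x: "x \<in> e" using e k by fastforce
  define F :: "('b \<Rightarrow> 'a) set" where "F = {x} \<rightarrow>\<^sub>E verts G"
  have F: "finite F" "card F = card (verts G)"
    unfolding F_def using hG by (auto intro: finite_PiE simp: card_PiE)
  let ?F = "{g \<in> extensional ({x} \<union> e). restrict g {x} \<in> F \<and> g ` e \<in> edges G}"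
  note ext = card_extensions_le[OF G F(1) singletonI x e]
  have "edge_maps {e} G \<subseteq> ?F"
    using x by (auto simp: edge_maps_def F_def PiE_iff extensional_def)
  then have "card (edge_maps {e} G) \<le> card ?F" using ext(1) by (rule card_mono[rotated])
  also note ext(2)
  finally show ?thesis using F by simp
qed

text \<open>The role of the connected components of \<open>S\<close> can be played by any inclusion-maximal nonempty
  \<open>T \<subseteq> S\<close> that satisfies the counting bound for connected sets: an edge of \<open>S\<close> meeting such
  a \<open>T\<close> could be added to it at the cost of one more factor, so maximality separates \<open>T\<close> from
  the rest of \<open>S\<close>.\<close>

lemma obtain_separated_part:
  fixes G :: "'a hypergraph" and S :: "'b set set"
  assumes G: "uniform_hypergraph k G" and k: "k > 0"
    and S: "finite S" "S \<noteq> {}" "\<And>e. e \<in> S \<Longrightarrow> finite e \<and> card e = k"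
  obtains T where "T \<subseteq> S" "T \<noteq> {}" "\<Union>T \<inter> \<Union>(S - T) = {}"
    "card (edge_maps T G) \<le> card (verts G) * (max_degree G * k ^ k) ^ card T"
proof -
  let ?D = "max_degree G * k ^ k"
  define \<T> where "\<T> = {T. T \<subseteq> S \<and> T \<noteq> {} \<and>
    card (edge_maps T G) \<le> card (verts G) * ?D ^ card T}"
  have fin: "finite \<T>"
    by (rule finite_subset[of _ "Pow S"]) (use S in \<open>auto simp: \<T>_def\<close>)
  obtain e where e: "e \<in> S" using S by auto
  have "{e} \<in> \<T>" using card_edge_maps_singleton_le[OF G _ _ k, of e] S(3)[OF e] e
    by (auto simp: \<T>_def)
  then obtain T where T: "T \<in> \<T>" and max: "\<And>T'. T' \<in> \<T> \<Longrightarrow> T \<subseteq> T' \<Longrightarrow> T = T'"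
    using finite_has_maximal[OF fin] by auto
  have TS: "T \<subseteq> S" and finT: "finite T" using T S(1) finite_subset by (auto simp: \<T>_def)
  have "\<Union>T \<inter> \<Union>(S - T) = {}"
  proof (rule ccontr)
    assume "\<Union>T \<inter> \<Union>(S - T) \<noteq> {}"
    then obtain x f where f: "f \<in> S" "f \<notin> T" "x \<in> f" "x \<in> \<Union>T" by auto
    have "finite (\<Union>T)" using finT TS S(3) by blast
    then have "card (edge_maps (insert f T) G) \<le> card (edge_maps T G) * ?D"
      using card_edge_maps_insert_le[OF G _ f(4,3)] S(3)[OF f(1)] by auto
    also have "\<dots> \<le> card (verts G) * ?D ^ card T * ?D"
      using T by (intro mult_right_mono) (auto simp: \<T>_def)
    also have "\<dots> = card (verts G) * ?D ^ card (insert f T)"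
      using f finT by (simp add: algebra_simps)
    finally have "insert f T \<in> \<T>" using TS f by (auto simp: \<T>_def)
    with max[of "insert f T"] f show False by auto
  qed
  with T show thesis using that by (auto simp: \<T>_def)
qed

lemma card_edge_maps_Un_le:
  fixes G :: "'a hypergraph" and T R :: "'b set set"
  assumes G: "finite (verts G)" and fin: "finite (\<Union>T)" "finite (\<Union>R)"
  shows "card (edge_maps (T \<union> R) G) \<le> card (edge_maps T G) * card (edge_maps R G)"
proof -
  let ?r = "\<lambda>g :: 'b \<Rightarrow> 'a. (restrict g (\<Union>T), restrict g (\<Union>R))"
  have inj: "inj_on ?r (edge_maps (T \<union> R) G)"
  proof (rule inj_onI)
    fix g h assume gh: "g \<in> edge_maps (T \<union> R) G" "h \<in> edge_maps (T \<union> R) G"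
      and eq: "?r g = ?r h"
    have "restrict g (\<Union>T) y = restrict h (\<Union>T) y" "restrict g (\<Union>R) y = restrict h (\<Union>R) y" for y
      using eq by auto
    then have "g y = h y" if "y \<in> \<Union>(T \<union> R)" for y
      using that by (metis UnE Union_Un_distrib restrict_apply')
    moreover have "g \<in> extensional (\<Union>(T \<union> R))" "h \<in> extensional (\<Union>(T \<union> R))"
      using gh by (auto simp: edge_maps_def PiE_iff)
    ultimately show "g = h" by (auto intro: extensionalityI)
  qed
  have sub: "?r ` edge_maps (T \<union> R) G \<subseteq> edge_maps T G \<times> edge_maps R G"
    using restrict_edge_maps[of _ "T \<union> R" G T] restrict_edge_maps[of _ "T \<union> R" G R] by auto
  show ?thesis
    using card_inj_on_le[OF inj sub] finite_edge_maps[OF fin(1) G] finite_edge_maps[OF fin(2) G]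
    by (simp add: card_cartesian_product)
qed

text \<open>The density hypothesis, applied to each part \<open>T\<close> split off from \<open>S\<close>, converts the single
  factor \<open>n\<close> paid for \<open>T\<close> into \<open>n\<close> to the power \<open>v(T) - |T|/m\<close>.  These exponents are additive over
  vertex-disjoint parts, which is why the bound need not mention the number of parts.\<close>

lemma card_edge_maps_le:
  fixes G :: "'a hypergraph" and S :: "'b set set" and m :: real
  assumes G: "uniform_hypergraph k G" and k: "k > 0" and m: "m > 0"
    and n: "card (verts G) \<ge> 1"
    and S: "finite S" "\<And>e. e \<in> S \<Longrightarrow> finite e \<and> card e = k"
    and dens: "\<And>T. T \<subseteq> S \<Longrightarrow> T \<noteq> {} \<Longrightarrow> real (card T) \<le> m * (real (card (\<Union>T)) - 1)"
  shows "real (card (edge_maps S G)) \<le> real (max_degree G * k ^ k) ^ card S *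
    real (card (verts G)) powr (real (card (\<Union>S)) - real (card S) / m)"
  using S dens
proof (induction "card S" arbitrary: S rule: less_induct)
  case less
  let ?D = "max_degree G * k ^ k"
  let ?n = "card (verts G)"
  have finV: "finite (verts G)"
    using G unfolding uniform_hypergraph_def hypergraph_def by auto
  show ?case
  proof (cases "S = {}")
    case True
    have "card (edge_maps {} G :: ('b \<Rightarrow> 'a) set) = 1" by (simp add: edge_maps_def)
    then show ?thesis using True n by simp
  next
    case False
    obtain T where T: "T \<subseteq> S" "T \<noteq> {}" "\<Union>T \<inter> \<Union>(S - T) = {}"
      and cT: "card (edge_maps T G) \<le> ?n * ?D ^ card T"
      using obtain_separated_part[OF G k less.prems(1) False less.prems(2)] by metis
    define R where "R = S - T"
    have SR: "S = T \<union> R" and disj: "T \<inter> R = {}" using T R_def by auto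
    have fin: "finite T" "finite R" using less.prems(1) SR by auto
    have finU: "finite (\<Union>T)" "finite (\<Union>R)" using fin less.prems(2) SR by auto
    have cS: "card S = card T + card R" using SR disj fin by (simp add: card_Un_disjoint)
    have cU: "card (\<Union>S) = card (\<Union>T) + card (\<Union>R)"
      using finU T(3) SR R_def by (metis Union_Un_distrib card_Un_disjoint)
    have "card T > 0" using fin T by (simp add: card_gt_0_iff)
    then have IH: "real (card (edge_maps R G)) \<le>
        real ?D ^ card R * real ?n powr (real (card (\<Union>R)) - real (card R) / m)"
      using less.hyps[of R] cS fin less.prems SR by auto
    have "real (card T) / m \<le> real (card (\<Union>T)) - 1"
      using less.prems(3)[OF T(1,2)] m by (simp add: field_simps)
    then have "real ?n powr 1 \<le> real ?n powr (real (card (\<Union>T)) - real (card T) / m)"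
      using n by (intro powr_mono) auto
    then have "real ?n \<le> real ?n powr (real (card (\<Union>T)) - real (card T) / m)"
      using n by simp
    then have "real ?n * real ?D ^ card T \<le>
        real ?n powr (real (card (\<Union>T)) - real (card T) / m) * real ?D ^ card T"
      by (intro mult_right_mono) auto
    moreover have "real (card (edge_maps T G)) \<le> real ?n * real ?D ^ card T"
      using cT by (metis of_nat_le_iff of_nat_mult of_nat_power)
    ultimately have bT: "real (card (edge_maps T G)) \<le>
        real ?D ^ card T * real ?n powr (real (card (\<Union>T)) - real (card T) / m)"
      by (simp add: mult.commute)
    have "real (card (edge_maps S G)) \<le> real (card (edge_maps T G)) * real (card (edge_maps R G))"
      using card_edge_maps_Un_le[OF finV finU] SR by (metis of_nat_le_iff of_nat_mult)
    also have "\<dots> \<le> (real ?D ^ card T * real ?n powr (real (card (\<Union>T)) - real (card T) / m)) *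
        (real ?D ^ card R * real ?n powr (real (card (\<Union>R)) - real (card R) / m))"
      by (intro mult_mono bT IH) auto
    also have "\<dots> = real ?D ^ card S *
        real ?n powr (real (card (\<Union>S)) - real (card S) / m)"
      unfolding cS cU by (simp add: power_add powr_add[symmetric] add_divide_distrib algebra_simps)
    finally show ?thesis .
  qed
qed

section \<open>Density\<close>

lemma finite_densities:
  assumes "hypergraph G"
  shows "finite {d1 G' | G'. subhypergraph G' G \<and> card (verts G') > 1}"
proof -
  let ?f = "\<lambda>(V, E). real (card E) / (real (card V) - 1)"
  have "{d1 G' | G'. subhypergraph G' G \<and> card (verts G') > 1} \<subseteq>
      ?f ` (Pow (verts G) \<times> Pow (edges G))"
    unfolding subhypergraph_def d1_def by force
  moreover have "finite (Pow (verts G) \<times> Pow (edges G))"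
    using assms finite_edges[OF assms] unfolding hypergraph_def by auto
  ultimately show ?thesis by (meson finite_imageI finite_subset)
qed

lemma d1_le_m1:
  assumes "hypergraph G" "subhypergraph G' G" "card (verts G') > 1"
  shows "d1 G' \<le> m1 G"
  unfolding m1_def using assms finite_densities[OF assms(1)] by (intro Max_ge) auto

lemma m1_nonneg:
  assumes "hypergraph G" "card (verts G) > 1"
  shows "m1 G \<ge> 0"
proof -
  have "0 \<le> d1 G" using assms unfolding d1_def by auto
  also have "\<dots> \<le> m1 G" using assms by (intro d1_le_m1) (auto simp: subhypergraph_def)
  finally show ?thesis .
qed

text \<open>Every edge contains a vertex, so \<open>v\<close> vertices span at most \<open>v\<close> times the maximum degree many
  edges, and \<open>v / (v - 1) \<le> 2\<close>.  An upper bound on \<open>m1 G\<close> uniform in \<open>n\<close> is what makes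
  the rate \<open>C' / n\<^bsup>1/m\<^esup>\<close> drop below 1.\<close>

lemma m1_le_max_degree:
  assumes G: "uniform_hypergraph k G" and k: "k > 0" and n: "card (verts G) > 1"
  shows "m1 G \<le> 2 * real (max_degree G)"
proof -
  have hG: "hypergraph G" using G unfolding uniform_hypergraph_def by auto
  have "d1 G' \<le> 2 * real (max_degree G)"
    if G': "subhypergraph G' G" "card (verts G') > 1" for G'
  proof -
    let ?V = "verts G'"
    have fV: "finite ?V" and sE: "edges G' \<subseteq> edges G" and eV: "edges G' \<subseteq> Pow ?V"
      using G' unfolding subhypergraph_def hypergraph_def by auto
    have "e \<noteq> {}" if "e \<in> edges G'" for e
      using that sE G k unfolding uniform_hypergraph_def by force
    then have "edges G' \<subseteq> (\<Union>v\<in>?V. {e \<in> edges G. v \<in> e})" using eV sE by blast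
    then have "card (edges G') \<le> card (\<Union>v\<in>?V. {e \<in> edges G. v \<in> e})"
      using fV finite_edges[OF hG] by (intro card_mono) auto
    also have "\<dots> \<le> (\<Sum>v\<in>?V. card {e \<in> edges G. v \<in> e})"
      using fV by (rule card_UN_le)
    also have "\<dots> \<le> (\<Sum>v\<in>?V. max_degree G)"
      using degree_le_max_degree[OF hG] by (intro sum_mono) auto
    finally have "card (edges G') \<le> card ?V * max_degree G" by simp
    then have "real (card (edges G')) \<le> real (card ?V) * real (max_degree G)"
      by (metis of_nat_le_iff of_nat_mult)
    also have "\<dots> \<le> (2 * (real (card ?V) - 1)) * real (max_degree G)"
      using G'(2) by (intro mult_right_mono) auto
    finally show ?thesis unfolding d1_def using G'(2) by (simp add: field_simps)
  qed
  moreover have "{d1 G' | G'. subhypergraph G' G \<and> card (verts G') > 1} \<noteq> {}"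
    using hG n by (auto simp: subhypergraph_def)
  ultimately show ?thesis
    unfolding m1_def using finite_densities[OF hG] by (subst Max_le_iff) auto
qed

text \<open>A set of edges covered by the image of an embedding is a copy of a subhypergraph of \<open>G\<close>, on
  the preimages of its vertices, so its density is controlled by that of \<open>G\<close>.\<close>

lemma card_le_m1_of_copy:
  fixes G :: "'a hypergraph" and T :: "'b set set"
  assumes G: "uniform_hypergraph k G" and k: "k \<ge> 2"
    and \<phi>: "inj_on \<phi> (verts G)" and T: "T \<subseteq> (\<lambda>e. \<phi> ` e) ` edges G" "T \<noteq> {}"
  shows "real (card T) \<le> m1 G * (real (card (\<Union>T)) - 1)"
proof -
  have hG: "hypergraph G" using G unfolding uniform_hypergraph_def by auto
  have fV: "finite (verts G)" and EV: "\<And>e. e \<in> edges G \<Longrightarrow> e \<subseteq> verts G"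
    using hG unfolding hypergraph_def by auto
  define E where "E = {e \<in> edges G. \<phi> ` e \<in> T}"
  have TE: "T = (\<lambda>e. \<phi> ` e) ` E" using T(1) E_def by auto
  have EsubV: "\<Union>E \<subseteq> verts G" using EV E_def by auto
  have "inj_on (\<lambda>e. \<phi> ` e) E"
    by (rule inj_onI) (use inj_on_image_eq_iff[OF \<phi>] EV E_def in auto)
  then have cT: "card T = card E" using TE by (simp add: card_image)
  have "\<Union>T = \<phi> ` \<Union>E" using TE by auto
  then have cU: "card (\<Union>T) = card (\<Union>E)"
    using \<phi> EsubV by (metis card_image inj_on_subset)
  have fE: "finite (\<Union>E)" using EsubV fV finite_subset by auto
  obtain e where e: "e \<in> E" using T(2) TE by auto
  then have "card e = k" using G E_def unfolding uniform_hypergraph_def by auto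
  moreover have "card e \<le> card (\<Union>E)" using e fE by (intro card_mono) auto
  ultimately have big: "card (\<Union>E) > 1" using k by simp
  let ?G' = "\<lparr>verts = \<Union>E, edges = E\<rparr>"
  have "d1 ?G' \<le> m1 G"
    using big fE EsubV by (intro d1_le_m1[OF hG]) (auto simp: subhypergraph_def hypergraph_def E_def)
  then have "real (card E) / (real (card (\<Union>E)) - 1) \<le> m1 G" by (simp add: d1_def)
  then show ?thesis unfolding cT cU using big by (simp add: divide_le_eq)
qed

section \<open>From vertex-spread to spread\<close>

lemma image_edges_in_copies:
  assumes G: "hypergraph G" and \<phi>: "\<phi> \<in> embeddings G H"
  shows "(\<lambda>e. \<phi> ` e) ` edges G \<in> copies G H"
proof -
  have inj: "inj_on \<phi> (verts G)" and VH: "\<phi> ` verts G \<subseteq> verts H"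
    and EH: "\<And>e. e \<in> edges G \<Longrightarrow> \<phi> ` e \<in> edges H"
    using \<phi> unfolding embeddings_def injections_def by auto
  have EV: "\<And>e. e \<in> edges G \<Longrightarrow> e \<subseteq> verts G" using G unfolding hypergraph_def by auto
  let ?G' = "\<lparr>verts = \<phi> ` verts G, edges = (\<lambda>e. \<phi> ` e) ` edges G\<rparr>"
  let ?f = "inv_into (verts G) \<phi>"
  have "(\<lambda>e. \<phi> ` e) ` edges G \<subseteq> Pow (\<phi> ` verts G)"
    by (intro image_subsetI PowI image_mono EV)
  then have "subhypergraph ?G' H"
    using G VH EH unfolding subhypergraph_def hypergraph_def by auto
  moreover have "bij_betw ?f (verts ?G') (verts G)"
    using inj by (simp add: bij_betw_inv_into inj_on_imp_bij_betw)
  moreover have "edges G = (\<lambda>e. ?f ` e) ` edges ?G'"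
  proof -
    have "?f ` \<phi> ` e = e" if "e \<in> edges G" for e
      using inj EV[OF that] by (simp add: inv_into_image_cancel)
    then have "(\<lambda>e. ?f ` \<phi> ` e) ` edges G = (\<lambda>e. e) ` edges G" by (intro image_cong) auto
    then show ?thesis by (simp add: image_image)
  qed
  ultimately have "subhypergraph ?G' H \<and> hypergraph_iso ?G' G"
    unfolding hypergraph_iso_def by blast
  then have "\<exists>G'. edges ?G' = edges G' \<and> subhypergraph G' H \<and> hypergraph_iso G' G" by blast
  then show ?thesis unfolding copies_def by simp
qed

text \<open>Prescribing the preimage of every point of \<open>W\<close>: a non-injective prescription is impossible,
  and an injective one lists the two sequences in the definition of vertex-spreadness.\<close>

lemma vertex_spread_prescribed_preimages:
  assumes sp: "vertex_spread q X Y \<mu>" and W: "W \<subseteq> Y" and \<psi>: "\<psi> ` W \<subseteq> X"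
  shows "measure_pmf.prob \<mu> {\<phi>. \<forall>w\<in>W. \<phi> (\<psi> w) = w} \<le> q ^ card W"
proof (cases "inj_on \<psi> W")
  case True
  have "finite W" using W sp finite_subset unfolding vertex_spread_def by auto
  then obtain ys where ys: "set ys = W" "distinct ys" using finite_distinct_list by auto
  let ?xs = "map \<psi> ys"
  have "distinct ?xs" using ys True by (simp add: distinct_map)
  moreover have "set ?xs \<subseteq> X" "set ys \<subseteq> Y" "length ?xs = length ys" using ys W \<psi> by auto
  ultimately have "measure_pmf.prob \<mu> {\<phi>. \<forall>i<length ?xs. \<phi> (?xs ! i) = ys ! i} \<le> q ^ length ?xs"
    using sp ys(2) unfolding vertex_spread_def by blast
  moreover have "{\<phi>. \<forall>i<length ?xs. \<phi> (?xs ! i) = ys ! i} = {\<phi>. \<forall>w\<in>W. \<phi> (\<psi> w) = w}"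
    unfolding ys(1)[symmetric] by (auto simp: all_set_conv_all_nth)
  moreover have "length ?xs = card W" using ys distinct_card by fastforce
  ultimately show ?thesis by simp
next
  case False
  then obtain a b where "a \<in> W" "b \<in> W" "a \<noteq> b" "\<psi> a = \<psi> b" unfolding inj_on_def by auto
  then have "{\<phi>. \<forall>w\<in>W. \<phi> (\<psi> w) = w} = {}" by (metis (mono_tags, lifting) Collect_empty_eq)
  moreover have "q \<ge> 0" using sp unfolding vertex_spread_def by auto
  ultimately show ?thesis by (metis measure_empty zero_le_power)
qed

text \<open>Union bound over the edge-preserving maps that can be the restriction of \<open>\<phi>\<^sup>-\<^sup>1\<close> to the
  vertices of \<open>S\<close>.\<close>

lemma prob_subset_image_le:
  fixes G :: "'a hypergraph" and H :: "'b hypergraph" and S :: "'b set set"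
  assumes G: "hypergraph G" and H: "hypergraph H" and S: "S \<subseteq> edges H"
    and \<mu>: "set_pmf \<mu> \<subseteq> embeddings G H" and sp: "vertex_spread q (verts G) (verts H) \<mu>"
  shows "measure_pmf.prob \<mu> {\<phi>. S \<subseteq> (\<lambda>e. \<phi> ` e) ` edges G}
    \<le> real (card (edge_maps S G)) * q ^ card (\<Union>S)"
proof -
  have EV: "\<And>e. e \<in> edges G \<Longrightarrow> e \<subseteq> verts G" and fVG: "finite (verts G)"
    using G unfolding hypergraph_def by auto
  have SH: "\<Union>S \<subseteq> verts H" using S H unfolding hypergraph_def by auto
  have finU: "finite (\<Union>S)" using SH H finite_subset unfolding hypergraph_def by auto
  have fin: "finite (edge_maps S G)" using finite_edge_maps[OF finU fVG] .
  let ?A = "\<lambda>\<psi>. {\<phi>. \<forall>w\<in>\<Union>S. \<phi> (\<psi> w) = w}"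
  have "{\<phi>. S \<subseteq> (\<lambda>e. \<phi> ` e) ` edges G} \<inter> set_pmf \<mu> \<subseteq> (\<Union>\<psi>\<in>edge_maps S G. ?A \<psi>)"
  proof
    fix \<phi> assume "\<phi> \<in> {\<phi>. S \<subseteq> (\<lambda>e. \<phi> ` e) ` edges G} \<inter> set_pmf \<mu>"
    then have sub: "S \<subseteq> (\<lambda>e. \<phi> ` e) ` edges G" and "\<phi> \<in> embeddings G H" using \<mu> by auto
    then have inj: "inj_on \<phi> (verts G)" unfolding embeddings_def injections_def by auto
    define \<psi> where "\<psi> = restrict (inv_into (verts G) \<phi>) (\<Union>S)"
    have USV: "\<Union>S \<subseteq> \<phi> ` verts G" using sub EV by blast
    have "\<psi> ` f \<in> edges G" if f: "f \<in> S" for f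
    proof -
      obtain e where e: "e \<in> edges G" "f = \<phi> ` e" using sub f by auto
      have "\<psi> ` f = inv_into (verts G) \<phi> ` f"
        unfolding \<psi>_def using f by (intro image_cong) auto
      also have "\<dots> = e" using e inj EV[OF e(1)] by (simp add: inv_into_image_cancel)
      finally show ?thesis using e by simp
    qed
    moreover have "\<psi> \<in> \<Union>S \<rightarrow>\<^sub>E verts G"
      unfolding \<psi>_def restrict_PiE_iff using USV by (meson inv_into_into subsetD)
    ultimately have "\<psi> \<in> edge_maps S G" unfolding edge_maps_def by simp
    moreover have "\<phi> (\<psi> w) = w" if "w \<in> \<Union>S" for w
    proof -
      have "\<phi> (inv_into (verts G) \<phi> w) = w" using that USV by (intro f_inv_into_f) blast
      then show ?thesis using that unfolding \<psi>_def by (simp only: restrict_apply')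
    qed
    ultimately show "\<phi> \<in> (\<Union>\<psi>\<in>edge_maps S G. ?A \<psi>)" by blast
  qed
  then have "measure_pmf.prob \<mu> ({\<phi>. S \<subseteq> (\<lambda>e. \<phi> ` e) ` edges G} \<inter> set_pmf \<mu>)
      \<le> measure_pmf.prob \<mu> (\<Union>\<psi>\<in>edge_maps S G. ?A \<psi>)"
    by (intro measure_pmf.finite_measure_mono) auto
  also have "\<dots> \<le> (\<Sum>\<psi>\<in>edge_maps S G. measure_pmf.prob \<mu> (?A \<psi>))"
    using fin by (intro measure_pmf.finite_measure_subadditive_finite) auto
  also have "\<dots> \<le> (\<Sum>\<psi>\<in>edge_maps S G. q ^ card (\<Union>S))"
  proof (rule sum_mono)
    fix \<psi> assume "\<psi> \<in> edge_maps S G"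
    then have "\<psi> ` \<Union>S \<subseteq> verts G" by (auto simp: edge_maps_def)
    then show "measure_pmf.prob \<mu> (?A \<psi>) \<le> q ^ card (\<Union>S)"
      by (rule vertex_spread_prescribed_preimages[OF sp SH])
  qed
  finally show ?thesis by (simp add: measure_Int_set_pmf)
qed

text \<open>The factor \<open>n\<^sup>v\<close> in the number of candidates cancels against \<open>(C/n)\<^sup>v\<close>.  If the event has
  positive probability and \<open>S\<close> is nonempty, then \<open>G\<close> has an edge, so \<open>m1 G\<close> is positive and the
  degenerate value of the rate does not occur.\<close>

lemma prob_subset_image_le_spread_rate:
  fixes G :: "'a hypergraph" and H :: "'b hypergraph" and S :: "'b set set" and C \<Delta> :: real
  assumes C: "C > 0" and k: "k \<ge> 2" and \<Delta>: "real (max_degree G) \<le> \<Delta>"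
    and G: "uniform_hypergraph k G" and H: "uniform_hypergraph k H"
    and n: "card (verts G) = n" "n > 1"
    and \<mu>: "set_pmf \<mu> \<subseteq> embeddings G H"
    and sp: "vertex_spread (C / real n) (verts G) (verts H) \<mu>"
    and S: "S \<subseteq> edges H"
  shows "measure_pmf.prob \<mu> {\<phi>. S \<subseteq> (\<lambda>e. \<phi> ` e) ` edges G}
    \<le> spread_rate (\<Delta> * real k ^ k * max 1 C ^ k) n (m1 G) ^ card S"
    (is "?P \<le> spread_rate ?C' n ?m ^ card S")
proof (cases "?P = 0")
  case True
  have "\<Delta> \<ge> 0" using \<Delta> by linarith
  then have "spread_rate ?C' n ?m \<ge> 0" unfolding spread_rate_def by auto
  then show ?thesis using True by simp
next
  case False
  have hG: "hypergraph G" and hH: "hypergraph H"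
    using G H unfolding uniform_hypergraph_def by auto
  have finS: "finite S" using S finite_edges[OF hH] finite_subset by auto
  have Se: "finite e \<and> card e = k" if "e \<in> S" for e
  proof -
    have "card e = k" using that S H unfolding uniform_hypergraph_def by auto
    then show ?thesis using k by (auto intro: card_ge_0_finite)
  qed
  \<comment> \<open>A single positive-probability outcome suffices to transfer the density of \<open>G\<close> to all of \<open>S\<close>.\<close>
  obtain \<phi> where \<phi>: "\<phi> \<in> set_pmf \<mu>" "S \<subseteq> (\<lambda>e. \<phi> ` e) ` edges G"
    using False by (auto simp: measure_pmf_zero_iff)
  have inj: "inj_on \<phi> (verts G)"
    using \<phi>(1) \<mu> unfolding embeddings_def injections_def by auto
  have dens: "real (card T) \<le> ?m * (real (card (\<Union>T)) - 1)" if "T \<subseteq> S" "T \<noteq> {}" for T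
    using card_le_m1_of_copy[OF G k inj _ that(2)] that(1) \<phi>(2) by blast
  show ?thesis
  proof (cases "S = {}")
    case True
    then show ?thesis by simp
  next
    case ne: False
    have "?m \<noteq> 0" using dens[OF order_refl ne] ne finS by auto
    then have m: "?m > 0" using m1_nonneg[OF hG] n by auto
    let ?s = "card S" and ?v = "card (\<Union>S)" and ?D = "real (max_degree G * k ^ k)"
    have cnt: "real (card (edge_maps S G)) \<le> ?D ^ ?s * real n powr (real ?v - real ?s / ?m)"
      using card_edge_maps_le[OF G _ m _ finS Se dens] k n by auto
    have v: "?v \<le> k * ?s"
    proof -
      have "card (\<Union>S) \<le> (\<Sum>e\<in>S. card e)" by (rule card_Union_le_sum_card)
      also have "\<dots> = (\<Sum>e\<in>S. k)" using Se by (intro sum.cong) auto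
      finally show ?thesis by (simp add: mult.commute)
    qed
    have "C ^ ?v \<le> max 1 C ^ ?v" using C by (intro power_mono) auto
    also have "\<dots> \<le> max 1 C ^ (k * ?s)" using v by (intro power_increasing) auto
    finally have Cv: "C ^ ?v \<le> (max 1 C ^ k) ^ ?s" by (simp add: power_mult)
    have D: "?D ^ ?s \<le> (\<Delta> * real k ^ k) ^ ?s"
      using \<Delta> by (intro power_mono) (auto intro!: mult_right_mono)
    have "?P \<le> real (card (edge_maps S G)) * (C / real n) ^ ?v"
      using prob_subset_image_le[OF hG hH S \<mu> sp] .
    also have "\<dots> \<le> (?D ^ ?s * real n powr (real ?v - real ?s / ?m)) * (C / real n) ^ ?v"
      using cnt C by (intro mult_right_mono) auto
    also have "\<dots> = ?D ^ ?s * C ^ ?v * real n powr (- (real ?s / ?m))"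
      using n by (simp add: powr_diff powr_minus powr_realpow power_divide field_simps)
    also have "\<dots> \<le> (\<Delta> * real k ^ k) ^ ?s * (max 1 C ^ k) ^ ?s * real n powr (- (real ?s / ?m))"
      using D Cv C by (intro mult_right_mono mult_mono order.trans[OF _ D]) auto
    also have "\<dots> = (?C' / real n powr (1 / ?m)) ^ ?s"
    proof -
      have "(real n powr (1 / ?m)) ^ ?s = real n powr (real ?s / ?m)"
        using n by (simp add: powr_realpow[symmetric] powr_powr)
      then show ?thesis by (simp add: power_divide power_mult_distrib powr_minus field_simps)
    qed
    finally show ?thesis using m by (simp add: spread_rate_def)
  qed
qed

text \<open>A rate above 1 is not admissible, so \<open>n\<close> has to be large enough in terms of \<open>C'\<close> and the
  degree bound.\<close>

lemma spread_rate_in_unit_interval: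
  fixes G :: "'a hypergraph" and C' \<Delta> :: real
  assumes C': "C' > 0" and \<Delta>: "\<Delta> > 0" "real (max_degree G) \<le> \<Delta>"
    and G: "uniform_hypergraph k G" "k > 0"
    and n: "card (verts G) = n" "n > 1" "real n \<ge> C' powr (2 * \<Delta>)"
  shows "spread_rate C' n (m1 G) \<in> {0..1}"
proof (cases "m1 G = 0")
  case True
  then show ?thesis by (simp add: spread_rate_def)
next
  case False
  have hG: "hypergraph G" using G unfolding uniform_hypergraph_def by auto
  have m: "m1 G > 0" using False m1_nonneg[OF hG] n by auto
  have "m1 G \<le> 2 * \<Delta>" using m1_le_max_degree[OF G] n \<Delta> by auto
  then have le: "1 / (2 * \<Delta>) \<le> 1 / m1 G" using m by (intro divide_left_mono) auto
  have "C' = (C' powr (2 * \<Delta>)) powr (1 / (2 * \<Delta>))" using C' \<Delta> by (simp add: powr_powr)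
  also have "\<dots> \<le> real n powr (1 / (2 * \<Delta>))" using n \<Delta> by (intro powr_mono2) auto
  also have "\<dots> \<le> real n powr (1 / m1 G)" using n le by (intro powr_mono) auto
  finally show ?thesis using C' n m by (simp add: spread_rate_def divide_le_eq)
qed

theorem proposition1p17:
  fixes C \<Delta> :: real and k :: nat
  assumes "C > 0" and "k \<ge> 2" and "\<Delta> > 0"
  shows "\<exists>C'>0. \<forall>\<^sub>F n in sequentially.
    \<forall>(G :: 'a hypergraph) (H :: 'b hypergraph).
      uniform_hypergraph k G \<longrightarrow> uniform_hypergraph k H \<longrightarrow>
      card (verts G) = n \<longrightarrow> card (verts H) = n \<longrightarrow>
      (\<exists>\<mu>. set_pmf \<mu> \<subseteq> embeddings G H \<and>
           vertex_spread (C / real n) (verts G) (verts H) \<mu>) \<longrightarrow>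
      real (max_degree G) \<le> \<Delta> \<longrightarrow>
      (\<exists>\<nu>. spread (spread_rate C' n (m1 G)) (edges H) (copies G H) \<nu>)"
proof -
  define C' where "C' = \<Delta> * real k ^ k * max 1 C ^ k"
  have C': "C' > 0" unfolding C'_def using assms by simp
  have "\<forall>\<^sub>F n in sequentially. n > 1 \<and> real n \<ge> C' powr (2 * \<Delta>)"
    using filterlim_real_sequentially
    by (intro eventually_conj eventually_gt_at_top) (auto simp: filterlim_at_top)
  then show ?thesis
  proof (intro exI[of _ C'] conjI C', elim eventually_mono, intro allI impI, elim conjE exE)
    fix n and G :: "'a hypergraph" and H :: "'b hypergraph" and \<mu>
    assume n: "n > 1" "real n \<ge> C' powr (2 * \<Delta>)"
      and G: "uniform_hypergraph k G" and H: "uniform_hypergraph k H"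
      and cG: "card (verts G) = n" and deg: "real (max_degree G) \<le> \<Delta>"
      and \<mu>: "set_pmf \<mu> \<subseteq> embeddings G H"
      and sp: "vertex_spread (C / real n) (verts G) (verts H) \<mu>"
    let ?q = "spread_rate C' n (m1 G)"
    have hG: "hypergraph G" and hH: "hypergraph H"
      using G H unfolding uniform_hypergraph_def by auto
    define \<nu> where "\<nu> = map_pmf (\<lambda>\<phi>. (\<lambda>e. \<phi> ` e) ` edges G) \<mu>"
    have "measure_pmf.prob \<nu> {A \<in> copies G H. S \<subseteq> A} \<le> ?q ^ card S" if S: "S \<subseteq> edges H" for S
    proof -
      have "measure_pmf.prob \<nu> {A \<in> copies G H. S \<subseteq> A} \<le> measure_pmf.prob \<nu> {A. S \<subseteq> A}"
        by (intro measure_pmf.finite_measure_mono) auto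
      also have "\<dots> = measure_pmf.prob \<mu> {\<phi>. S \<subseteq> (\<lambda>e. \<phi> ` e) ` edges G}"
        unfolding \<nu>_def by (simp add: vimage_def)
      also have "\<dots> \<le> ?q ^ card S"
        unfolding C'_def
        using prob_subset_image_le_spread_rate[OF assms(1,2) deg G H cG n(1) \<mu> sp S] .
      finally show ?thesis .
    qed
    moreover have "set_pmf \<nu> \<subseteq> copies G H"
      unfolding \<nu>_def using image_edges_in_copies[OF hG] \<mu> by auto
    moreover have "copies G H \<subseteq> Pow (edges H)"
      unfolding copies_def subhypergraph_def by auto
    moreover have "?q \<in> {0..1}"
      using spread_rate_in_unit_interval[OF C' assms(3) deg G _ cG n] assms(2) by simp
    ultimately have "spread ?q (edges H) (copies G H) \<nu>"
      unfolding spread_def using finite_edges[OF hH] by auto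
    then show "\<exists>\<nu>. spread ?q (edges H) (copies G H) \<nu>" by blast
  qed
qed

end
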